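(* Let $q\ge 1$ be an integer and let $T$ be an infinite $(q+1)$-homogeneous tree rooted at $o$. For $0<p\le\infty$, $\mathbb{T}_{p,0}$ is a separable space.
   Context: A $(q+1)$-homogeneous tree is a connected graph without cycles in which every vertex has exactly $q+1$ neighbours; rooted means that a vertex $o$ (the root) is singled out. For a vertex $v$, $|v|$ is the number of edges in the unique path from $o$ to $v$; for $n\ge1$ there are $(q+1)q^{n-1}$ vertices with $|v|=n$. Functions on $T$ are functions on its vertices. $\mathbb{N}=\{1,2,\dots\}$, $\mathbb{N}_0=\mathbb{N}\cup\{0\}$. For $f\colon T\to\mathbb{C}$ and $n\in\mathbb{N}$, $M_p(n,f)=\left(\frac{1}{(q+1)q^{n-1}}\sum_{|v|=n}|f(v)|^p\right)^{1/p}$ if $0<p<\infty$, $M_\infty(n,f)=\max_{|v|=n}|f(v)|$, and $M_p(0,f)=|f(o)|$ for all $p\in(0,\infty]$. Put $\|f\|_p=\sup_{n\in\mathbb{N}_0}M_p(n,f)$, $\mathbb{T}_p=\{f\colon T\to\mathbb{C}:\|f\|_p<\infty\}$ and $\mathbb{T}_{p,0}=\{f\in\mathbb{T}_p:\lim_{n\to\infty}M_p(n,f)=0\}$. The topology is that determined by $\|\cdot\|_p$: $f_k\to f$ means $\|f_k-f\|_p\to0$ (metric $\|f-g\|_p$ for $p\ge1$, and $\|f-g\|_p^p$ for $0<p<1$). Separable means having a countable dense subset. *)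

theory Defs
  imports "HOL-Analysis.Analysis"
begin

(* The vertex set of a graph is the whole type 'v, and E is its adjacency relation. *)

definition gpath :: "('v \<Rightarrow> 'v \<Rightarrow> bool) \<Rightarrow> 'v list \<Rightarrow> bool" where
  "gpath E xs \<longleftrightarrow> xs \<noteq> [] \<and> distinct xs \<and> successively E xs"

definition gcycle :: "('v \<Rightarrow> 'v \<Rightarrow> bool) \<Rightarrow> 'v list \<Rightarrow> bool" where
  "gcycle E xs \<longleftrightarrow> length xs \<ge> 3 \<and> distinct xs \<and> successively E xs \<and> E (last xs) (hd xs)"

(* In degree, the set of neighbours is automatically finite, since its cardinality is nonzero. *)

locale homogeneous_tree =
  fixes q :: nat and E :: "'v \<Rightarrow> 'v \<Rightarrow> bool"
  assumes sym: "symp E"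
    and irrefl: "irreflp E"
    and connected: "\<And>u v. \<exists>xs. gpath E xs \<and> hd xs = u \<and> last xs = v"
    and no_cycle: "\<nexists>xs. gcycle E xs"
    and degree: "\<And>v. card {w. E v w} = q + 1"

definition level :: "('v \<Rightarrow> 'v \<Rightarrow> bool) \<Rightarrow> 'v \<Rightarrow> 'v \<Rightarrow> nat" where
  "level E rt v = length (THE xs. gpath E xs \<and> hd xs = rt \<and> last xs = v) - 1"

definition sphere_at :: "('v \<Rightarrow> 'v \<Rightarrow> bool) \<Rightarrow> 'v \<Rightarrow> nat \<Rightarrow> 'v set" where
  "sphere_at E rt n = {v. level E rt v = n}"

(* The exponent p ranges over (0, \<infinity>]; the definitions below are meant only for p > 0. *)

definition mean :: "nat \<Rightarrow> ('v \<Rightarrow> 'v \<Rightarrow> bool) \<Rightarrow> 'v \<Rightarrow> ennreal \<Rightarrow> nat \<Rightarrow> ('v \<Rightarrow> complex) \<Rightarrow> real" where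
  "mean q E rt p n f =
     (if n = 0 then cmod (f rt)
      else if p = \<infinity> then Max ((\<lambda>v. cmod (f v)) ` sphere_at E rt n)
      else (1 / (real (q + 1) * real q ^ (n - 1)) *
             (\<Sum>v\<in>sphere_at E rt n. cmod (f v) powr enn2real p)) powr (1 / enn2real p))"

definition T_norm :: "nat \<Rightarrow> ('v \<Rightarrow> 'v \<Rightarrow> bool) \<Rightarrow> 'v \<Rightarrow> ennreal \<Rightarrow> ('v \<Rightarrow> complex) \<Rightarrow> ennreal" where
  "T_norm q E rt p f = (SUP n. ennreal (mean q E rt p n f))"

definition T_space :: "nat \<Rightarrow> ('v \<Rightarrow> 'v \<Rightarrow> bool) \<Rightarrow> 'v \<Rightarrow> ennreal \<Rightarrow> ('v \<Rightarrow> complex) set" where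
  "T_space q E rt p = {f. T_norm q E rt p f < \<infinity>}"

definition T_space0 :: "nat \<Rightarrow> ('v \<Rightarrow> 'v \<Rightarrow> bool) \<Rightarrow> 'v \<Rightarrow> ennreal \<Rightarrow> ('v \<Rightarrow> complex) set" where
  "T_space0 q E rt p = {f \<in> T_space q E rt p. (\<lambda>n. mean q E rt p n f) \<longlonglongrightarrow> 0}"

definition T_dist ::
  "nat \<Rightarrow> ('v \<Rightarrow> 'v \<Rightarrow> bool) \<Rightarrow> 'v \<Rightarrow> ennreal \<Rightarrow> ('v \<Rightarrow> complex) \<Rightarrow> ('v \<Rightarrow> complex) \<Rightarrow> real" where
  "T_dist q E rt p f g =
     (if p \<ge> 1 then enn2real (T_norm q E rt p (\<lambda>v. f v - g v))
      else enn2real (T_norm q E rt p (\<lambda>v. f v - g v)) powr enn2real p)"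

definition T_top0 :: "nat \<Rightarrow> ('v \<Rightarrow> 'v \<Rightarrow> bool) \<Rightarrow> 'v \<Rightarrow> ennreal \<Rightarrow> ('v \<Rightarrow> complex) topology" where
  "T_top0 q E rt p = Metric_space.mtopology (T_space0 q E rt p) (T_dist q E rt p)"

end

(* Finitely supported functions with values in a countable dense subset of the complex numbers
   form a countable set, because spheres are finite. They are dense: the means of f are small outside
   a large ball, where f may be replaced by 0, and inside the ball a perturbation of f by at most d at
   each vertex changes the means by at most d. *)

theory Submission
  imports Defs
begin

section \<open>Paths and spheres in a homogeneous tree\<close>

context homogeneous_tree
begin

text \<open>Two paths from a common start either continue to the same vertex, and induction applies
  to the tails, or they separate and must meet again, which closes a cycle.\<close>

lemma gpath_unique:
  assumes "gpath E xs" "gpath E ys" "hd xs = hd ys" "last xs = last ys"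
  shows "xs = ys"
  using assms
proof (induction xs arbitrary: ys)
  case Nil
  then show ?case by (simp add: gpath_def)
next
  case (Cons x xs)
  then obtain ys' where ys: "ys = x # ys'"
    by (cases ys) (auto simp: gpath_def)
  have dist: "x \<notin> set xs" "x \<notin> set ys'" "distinct xs" "distinct ys'"
    and succ: "successively E (x # xs)" "successively E (x # ys')"
    using Cons.prems unfolding ys gpath_def by auto
  consider "xs = [] \<or> ys' = []" | "xs \<noteq> []" "ys' \<noteq> []" "hd xs = hd ys'"
    | "xs \<noteq> []" "ys' \<noteq> []" "hd xs \<noteq> hd ys'" by blast
  then show ?case
  proof cases
    case 1
    \<comment> \<open>If one tail is empty, the common end is \<open>x\<close>, which distinctness
      keeps out of the other tail.\<close>
    then show ?thesis
      using Cons.prems(4) dist last_in_set[of xs] last_in_set[of ys'] unfolding ys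
      by (cases "xs = []"; cases "ys' = []") auto
  next
    case 2
    then have "xs = ys'"
      using Cons.prems Cons.IH[of ys'] dist succ unfolding ys gpath_def
      by (auto simp: successively_Cons)
    then show ?thesis by (simp add: ys)
  next
    case 3
    have "last ys' \<in> set ys'" "last ys' \<in> set xs"
      using 3 Cons.prems(4) last_in_set[of xs] last_in_set[of ys'] by (auto simp: ys)
    \<comment> \<open>Taking the first vertex of \<open>ys'\<close> that lies on \<open>xs\<close>
      keeps \<open>ys1\<close> disjoint from \<open>xs\<close>; hence the cycle below has distinct
      vertices.\<close>
    then obtain ys1 z ys2 where ys': "ys' = ys1 @ z # ys2" and z: "z \<in> set xs"
      and disj: "\<forall>y\<in>set ys1. y \<notin> set xs"
      using split_list_first_prop[of ys' "\<lambda>y. y \<in> set xs"] by blast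
    obtain xs1 xs2 where xs: "xs = xs1 @ z # xs2"
      using z split_list by metis
    \<comment> \<open>Out along the first path to \<open>z\<close>, back along the second; the
      closing edge joins \<open>x\<close> to the first vertex of \<open>ys'\<close>.\<close>
    define cyc where "cyc = x # xs1 @ z # rev ys1"
    have symE: "E v u \<longleftrightarrow> E u v" for u v using sym by (auto simp: symp_def)
    have "distinct cyc"
      using dist disj by (auto simp: cyc_def xs ys')
    moreover have "successively E cyc"
      using succ unfolding cyc_def xs ys'
      by (auto simp: successively_append_iff successively_Cons symE last_rev hd_rev hd_append
               split: if_splits)
    \<comment> \<open>Length 2 would need both \<open>xs1\<close> and \<open>ys1\<close> empty, and
      then both tails would start with \<open>z\<close>.\<close>
    moreover have "length cyc \<ge> 3"
      using 3 by (cases xs1; cases ys1) (auto simp: cyc_def xs ys')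
    moreover have "E (last cyc) (hd cyc)"
      using succ(2) symE unfolding cyc_def ys'
      by (cases ys1) (auto simp: last_rev successively_Cons)
    ultimately show ?thesis
      using no_cycle by (auto simp: gcycle_def)
  qed
qed

text \<open>Uniqueness of paths makes the \<open>THE\<close> in \<open>level\<close> meaningful, so
  any path to a vertex computes its level.\<close>

lemma level_eq:
  assumes "gpath E xs"
  shows "level E (hd xs) (last xs) = length xs - 1"
proof -
  have "(THE ys. gpath E ys \<and> hd ys = hd xs \<and> last ys = last xs) = xs"
    using assms gpath_unique by (intro the_equality) auto
  then show ?thesis by (simp add: level_def)
qed

section \<open>Spheres: finiteness, size and nonemptiness\<close>

lemma sphere_path:
  assumes "v \<in> sphere_at E rt n"
  obtains xs where "gpath E xs" "hd xs = rt" "last xs = v" "length xs = Suc n"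
proof -
  obtain xs where xs: "gpath E xs" "hd xs = rt" "last xs = v"
    using connected by blast
  moreover have "length xs = Suc n"
    using level_eq[OF xs(1)] assms xs by (cases xs) (auto simp: sphere_at_def gpath_def)
  ultimately show thesis using that by blast
qed

lemma sphere_0: "sphere_at E rt 0 = {rt}"
proof -
  have "v = rt" if "v \<in> sphere_at E rt 0" for v
    using sphere_path[OF that] by (metis append_Nil2 hd_Cons_tl last_ConsL length_0_conv
        length_Suc_conv list.sel(1))
  moreover have "rt \<in> sphere_at E rt 0"
    using level_eq[of "[rt]"] by (simp add: sphere_at_def gpath_def)
  ultimately show ?thesis by blast
qed

text \<open>Deleting the last vertex of the path from the root leaves a path to the parent, one
  level lower.\<close>

lemma sphere_Suc:
  assumes "v \<in> sphere_at E rt (Suc n)"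
  obtains u where "u \<in> sphere_at E rt n" "E u v"
proof -
  obtain ys where ys: "gpath E ys" "hd ys = rt" "last ys = v" "length ys = Suc (Suc n)"
    using sphere_path[OF assms] .
  define xs where "xs = butlast ys"
  have eq: "ys = xs @ [v]"
    using ys unfolding xs_def by (metis append_butlast_last_id list.size(3) nat.distinct(1))
  have len: "length xs = Suc n" using ys eq by simp
  then have ne: "xs \<noteq> []" by auto
  have p: "gpath E xs" and e: "E (last xs) v"
    using ys(1) ne unfolding eq gpath_def by (auto simp: successively_append_iff)
  have h: "hd xs = rt" using ys(2) ne by (simp add: eq)
  have "last xs \<in> sphere_at E rt n"
    using level_eq[OF p] h len by (simp add: sphere_at_def)
  then show thesis using that e by blast
qed

lemma finite_neighbours: "finite {w. E v w}"
  using degree[of v] card.infinite by fastforce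

lemma sphere_Suc_subset: "sphere_at E rt (Suc n) \<subseteq> (\<Union>u\<in>sphere_at E rt n. {w. E u w})"
proof
  fix v assume "v \<in> sphere_at E rt (Suc n)"
  then show "v \<in> (\<Union>u\<in>sphere_at E rt n. {w. E u w})"
    by (rule sphere_Suc) blast
qed

lemma finite_sphere: "finite (sphere_at E rt n)"
proof (induction n)
  case 0
  then show ?case by (simp add: sphere_0)
next
  case (Suc n)
  then show ?case
    using finite_neighbours by (intro finite_subset[OF sphere_Suc_subset] finite_UN_I) auto
qed

text \<open>A vertex other than the root spends one of its q + 1 neighbours on its parent, so at
  most q of them lie on the next sphere. The bound keeps the mean of a constant below that
  constant.\<close>

lemma card_sphere_Suc_le: "card (sphere_at E rt (Suc n)) \<le> (q + 1) * q ^ n"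
proof (induction n)
  case 0
  have "card (sphere_at E rt (Suc 0)) \<le> card {w. E rt w}"
    using sphere_Suc_subset[of rt 0] finite_neighbours by (intro card_mono) (auto simp: sphere_0)
  then show ?case by (simp add: degree)
next
  case (Suc n)
  have "\<exists>w. E u w \<and> sphere_at E rt (Suc (Suc n)) \<inter> {w'. E u w'} \<subseteq> {w'. E u w'} - {w}"
    if u: "u \<in> sphere_at E rt (Suc n)" for u
  proof -
    obtain w where w: "w \<in> sphere_at E rt n" "E w u"
      by (rule sphere_Suc[OF u])
    have "E u w" using w(2) sym by (auto simp: symp_def)
    \<comment> \<open>The parent has level n, not n + 2.\<close>
    moreover have "w \<notin> sphere_at E rt (Suc (Suc n))"
      using w(1) by (simp add: sphere_at_def)
    ultimately show ?thesis by blast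
  qed
  then obtain par where par: "\<And>u. u \<in> sphere_at E rt (Suc n) \<Longrightarrow> E u (par u)"
    "\<And>u. u \<in> sphere_at E rt (Suc n) \<Longrightarrow>
      sphere_at E rt (Suc (Suc n)) \<inter> {w. E u w} \<subseteq> {w. E u w} - {par u}"
    by metis
  have "sphere_at E rt (Suc (Suc n)) \<subseteq> (\<Union>u\<in>sphere_at E rt (Suc n). {w. E u w} - {par u})"
    using sphere_Suc_subset[of rt "Suc n"] par(2) by blast
  then have "card (sphere_at E rt (Suc (Suc n)))
      \<le> card (\<Union>u\<in>sphere_at E rt (Suc n). {w. E u w} - {par u})"
    using finite_sphere finite_neighbours by (intro card_mono) auto
  also have "\<dots> \<le> (\<Sum>u\<in>sphere_at E rt (Suc n). card ({w. E u w} - {par u}))"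
    by (rule card_UN_le[OF finite_sphere])
  also have "\<dots> = card (sphere_at E rt (Suc n)) * q"
    using par(1) finite_neighbours degree by (simp add: card_Diff_singleton)
  also have "\<dots> \<le> (q + 1) * q ^ n * q"
    using Suc.IH by (rule mult_right_mono) simp
  finally show ?case by (simp add: mult_ac)
qed

text \<open>An empty sphere empties all later ones, and the tree would be a finite union of finite
  spheres.\<close>

lemma sphere_nonempty:
  assumes "infinite (UNIV :: 'v set)"
  shows "sphere_at E rt n \<noteq> {}"
proof
  assume empty: "sphere_at E rt n = {}"
  have "sphere_at E rt m = {}" if "m \<ge> n" for m
    using that by (induction m rule: dec_induct) (use empty sphere_Suc_subset in blast)+
  then have "level E rt v < n" for v
    by (metis (mono_tags, lifting) empty_iff mem_Collect_eq not_le sphere_at_def)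
  then have "v \<in> (\<Union>i<n. sphere_at E rt i)" for v
    by (auto simp: sphere_at_def)
  then have "UNIV = (\<Union>i<n. sphere_at E rt i)" by blast
  then show False using assms finite_sphere by (metis finite_UN finite_lessThan)
qed

end

section \<open>Subadditivity of power means\<close>

text \<open>After division by a + b both terms lie in [0,1], where t is at most
  \<open>t powr s\<close>; the two fractions add up to 1.\<close>

lemma powr_subadd:
  fixes a b s :: real
  assumes "0 \<le> a" "0 \<le> b" "0 < s" "s \<le> 1"
  shows "(a + b) powr s \<le> a powr s + b powr s"
proof (cases "a + b = 0")
  case True
  then show ?thesis using assms by simp
next
  case False
  then have pos: "a + b > 0" using assms by simp
  have "t \<le> t powr s" if "0 \<le> t" "t \<le> 1" for t :: real
    using powr_mono'[of s 1 t] that assms by simp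
  then have "a / (a + b) \<le> (a / (a + b)) powr s" "b / (a + b) \<le> (b / (a + b)) powr s"
    using assms pos by (simp_all add: divide_le_eq_1)
  moreover have "a / (a + b) + b / (a + b) = 1" using pos by (simp add: divide_simps)
  ultimately have "1 \<le> (a powr s + b powr s) / (a + b) powr s"
    using assms pos by (simp add: powr_divide add_divide_distrib)
  then show ?thesis using pos by (simp add: divide_simps)
qed

text \<open>The endpoint 0 is included because functions on the tree may vanish. If one argument is
  0, the claim reduces to \<open>u powr p\<close> being at most u for u in (0,1).\<close>

lemma powr_convex_nonneg:
  fixes p :: real
  assumes "p \<ge> 1"
  shows "convex_on {0..} (\<lambda>x::real. x powr p)"
proof (rule convex_onI)
  fix t x y :: real
  assume t: "0 < t" "t < 1" and "x \<in> {0..}" "y \<in> {0..}"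
  then have xy: "0 \<le> x" "0 \<le> y" by auto
  have le: "u powr p \<le> u" if "0 < u" "u < 1" for u :: real
    using powr_mono'[of 1 p u] that assms by simp
  consider "x > 0" "y > 0" | "x = 0" | "y = 0" using xy by linarith
  then show "((1 - t) *\<^sub>R x + t *\<^sub>R y) powr p \<le> (1 - t) * x powr p + t * y powr p"
  proof cases
    case 1
    then show ?thesis
      using convex_onD[OF powr_convex[OF assms], of t x y] t by simp
  next
    case 2
    then show ?thesis
      using le[of t] t xy assms by (simp add: powr_mult mult_right_mono)
  next
    case 3
    then show ?thesis
      using le[of "1 - t"] t xy assms by (simp add: powr_mult mult_right_mono)
  qed
qed simp

text \<open>Minkowski's inequality with a constant weight. After scaling by the two norms, (a + b) /
  (\<alpha> + \<beta>) is a convex combination of a / \<alpha> and b / \<beta>, and convexity of the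
  power is summed over \<open>A\<close>.\<close>

lemma minkowski_sum:
  fixes a b :: "'a \<Rightarrow> real" and c p :: real
  assumes p: "p \<ge> 1" and c: "c > 0" and fin: "finite A"
    and a: "\<And>x. x \<in> A \<Longrightarrow> 0 \<le> a x" and b: "\<And>x. x \<in> A \<Longrightarrow> 0 \<le> b x"
  shows "(c * (\<Sum>x\<in>A. (a x + b x) powr p)) powr (1 / p)
    \<le> (c * (\<Sum>x\<in>A. a x powr p)) powr (1 / p) + (c * (\<Sum>x\<in>A. b x powr p)) powr (1 / p)"
proof -
  define \<alpha> where "\<alpha> = (c * (\<Sum>x\<in>A. a x powr p)) powr (1 / p)"
  define \<beta> where "\<beta> = (c * (\<Sum>x\<in>A. b x powr p)) powr (1 / p)"
  have nn: "\<alpha> \<ge> 0" "\<beta> \<ge> 0" by (simp_all add: \<alpha>_def \<beta>_def)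
  have \<alpha>p: "c * (\<Sum>x\<in>A. a x powr p) = \<alpha> powr p" and \<beta>p: "c * (\<Sum>x\<in>A. b x powr p) = \<beta> powr p"
    using p c by (simp_all add: \<alpha>_def \<beta>_def powr_powr sum_nonneg)
  \<comment> \<open>The scaling divides by both norms; a norm that is 0 forces its function to
    vanish on \<open>A\<close>.\<close>
  consider "\<alpha> = 0" | "\<beta> = 0" | "\<alpha> > 0" "\<beta> > 0" using nn by linarith
  then show ?thesis
  proof cases
    case 1
    then have "\<forall>x\<in>A. a x = 0" using \<alpha>p c fin by (auto simp: sum_nonneg_eq_0_iff)
    then show ?thesis by simp
  next
    case 2
    then have "\<forall>x\<in>A. b x = 0" using \<beta>p c fin by (auto simp: sum_nonneg_eq_0_iff)
    then show ?thesis by simp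
  next
    case 3
    define t where "t = \<beta> / (\<alpha> + \<beta>)"
    have t: "0 \<le> t" "t \<le> 1" "1 - t = \<alpha> / (\<alpha> + \<beta>)"
      using 3 by (auto simp: t_def divide_simps)
    have "(a x + b x) powr p
        \<le> (\<alpha> + \<beta>) powr p * ((1 - t) * (a x powr p / \<alpha> powr p) + t * (b x powr p / \<beta> powr p))"
      if "x \<in> A" for x
    proof -
      have "a x + b x = (\<alpha> + \<beta>) * ((1 - t) * (a x / \<alpha>) + t * (b x / \<beta>))"
        using 3 unfolding t(3) unfolding t_def by (simp add: distrib_left)
      then have "(a x + b x) powr p
          = (\<alpha> + \<beta>) powr p * ((1 - t) * (a x / \<alpha>) + t * (b x / \<beta>)) powr p"
        using 3 a b that t by (simp add: powr_mult)
      also have "((1 - t) * (a x / \<alpha>) + t * (b x / \<beta>)) powr p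
          \<le> (1 - t) * (a x / \<alpha>) powr p + t * (b x / \<beta>) powr p"
        using convex_onD[OF powr_convex_nonneg[OF p], of t "a x / \<alpha>" "b x / \<beta>"] 3 a b that t
        by simp
      finally show ?thesis using 3 a b that by (simp add: powr_divide mult_left_mono)
    qed
    then have "c * (\<Sum>x\<in>A. (a x + b x) powr p) \<le> c * (\<Sum>x\<in>A.
        (\<alpha> + \<beta>) powr p * ((1 - t) * (a x powr p / \<alpha> powr p) + t * (b x powr p / \<beta> powr p)))"
      using c by (intro mult_left_mono sum_mono) auto
    also have "\<dots> = c * ((\<alpha> + \<beta>) powr p * ((1 - t) * ((\<Sum>x\<in>A. a x powr p) / \<alpha> powr p)
        + t * ((\<Sum>x\<in>A. b x powr p) / \<beta> powr p)))"
      by (simp add: sum.distrib flip: sum_distrib_left sum_divide_distrib)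
    also have "\<dots> = (\<alpha> + \<beta>) powr p * ((1 - t) * ((c * (\<Sum>x\<in>A. a x powr p)) / \<alpha> powr p)
        + t * ((c * (\<Sum>x\<in>A. b x powr p)) / \<beta> powr p))"
      by (simp add: algebra_simps)
    \<comment> \<open>By the choice of \<alpha> and \<beta> both quotients equal 1, and the weights
      1 - t and t sum to 1.\<close>
    also have "\<dots> = (\<alpha> + \<beta>) powr p"
      using 3 by (simp add: \<alpha>p \<beta>p)
    finally have "(c * (\<Sum>x\<in>A. (a x + b x) powr p)) powr (1 / p) \<le> ((\<alpha> + \<beta>) powr p) powr (1 / p)"
      using p c by (intro powr_mono2) (auto intro!: mult_nonneg_nonneg sum_nonneg)
    also have "\<dots> = \<alpha> + \<beta>" using p 3 by (simp add: powr_powr)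
    finally show ?thesis by (simp add: \<alpha>_def \<beta>_def)
  qed
qed

section \<open>The metric on the space of functions\<close>

locale tree_space = homogeneous_tree q E
  for q :: nat and E :: "'v \<Rightarrow> 'v \<Rightarrow> bool" +
  fixes rt :: 'v and p :: ennreal
  assumes q_ge_1: "q \<ge> 1"
    and infinite_vertices: "infinite (UNIV :: 'v set)"
    and p_pos: "0 < p"
begin

abbreviation "S \<equiv> sphere_at E rt"
abbreviation "M \<equiv> mean q E rt p"
abbreviation "N f \<equiv> enn2real (T_norm q E rt p f)"

text \<open>The power of the quasi-norm that satisfies the triangle inequality.\<close>

definition r :: real where "r = (if p \<ge> 1 then 1 else enn2real p)"

definition c :: "nat \<Rightarrow> real" where "c n = 1 / (real (q + 1) * real q ^ (n - 1))"

text \<open>\<open>enn2real\<close> sends infinity to 0, hence the restriction to finite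
  exponents.\<close>

lemma enn2real_p_pos: "p \<noteq> \<infinity> \<Longrightarrow> 0 < enn2real p"
  using p_pos by (simp add: enn2real_positive_iff top.not_eq_extremum)

lemma enn2real_p_ge_1: "p \<noteq> \<infinity> \<Longrightarrow> 1 \<le> p \<Longrightarrow> 1 \<le> enn2real p"
  by (cases p) (auto simp flip: ennreal_1)

lemma p_less_1: assumes "\<not> 1 \<le> p" shows "p \<noteq> \<infinity>" "enn2real p < 1"
  using assms by (cases p; auto simp flip: ennreal_1)+

lemma r_pos: "0 < r" and r_le_1: "r \<le> 1"
  using enn2real_p_pos p_less_1 by (auto simp: r_def intro: less_imp_le)

lemma c_pos: "0 < c n"
  using q_ge_1 by (simp add: c_def)

section \<open>Means over a single sphere\<close>

lemma mean_0: "M 0 f = cmod (f rt)"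
  by (simp add: mean_def)

lemma mean_infinity: "n \<noteq> 0 \<Longrightarrow> p = \<infinity> \<Longrightarrow> M n f = Max ((\<lambda>v. cmod (f v)) ` S n)"
  by (simp add: mean_def)

lemma mean_finite:
  "n \<noteq> 0 \<Longrightarrow> p \<noteq> \<infinity> \<Longrightarrow>
    M n f = (c n * (\<Sum>v\<in>S n. cmod (f v) powr enn2real p)) powr (1 / enn2real p)"
  by (simp add: mean_def c_def)

lemma S_nonempty: "S n \<noteq> {}"
  by (rule sphere_nonempty[OF infinite_vertices])

lemma mean_cases:
  obtains "n = 0" | "n \<noteq> 0" "p = \<infinity>" | "n \<noteq> 0" "p \<noteq> \<infinity>"
  by blast

lemma mean_nonneg: "0 \<le> M n f"
proof (cases n rule: mean_cases)
  case 1
  then show ?thesis by (simp add: mean_0)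
next
  case 2
  \<comment> \<open>\<open>Max\<close> says nothing about an empty set, so a vertex on the sphere is
    needed.\<close>
  obtain v where "v \<in> S n" using S_nonempty by blast
  then have "cmod (f v) \<le> M n f"
    using finite_sphere by (simp add: mean_infinity[OF 2])
  then show ?thesis using norm_ge_zero order_trans by blast
next
  case 3
  then show ?thesis by (simp add: mean_finite)
qed

lemma mean_mono:
  assumes "\<And>v. v \<in> S n \<Longrightarrow> cmod (f v) \<le> cmod (g v)"
  shows "M n f \<le> M n g"
proof (cases n rule: mean_cases)
  case 1
  then show ?thesis using assms[of rt] by (simp add: mean_0 sphere_0)
next
  case 2
  have "cmod (f v) \<le> Max ((\<lambda>v. cmod (g v)) ` S n)" if "v \<in> S n" for v
    using assms[OF that] that finite_sphere by (intro order_trans[OF _ Max_ge]) auto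
  then show ?thesis
    using finite_sphere S_nonempty by (simp add: mean_infinity[OF 2])
next
  case 3
  have "(\<Sum>v\<in>S n. cmod (f v) powr enn2real p) \<le> (\<Sum>v\<in>S n. cmod (g v) powr enn2real p)"
    using assms enn2real_p_pos 3 by (intro sum_mono powr_mono2) (auto intro: less_imp_le)
  then show ?thesis
    using 3 enn2real_p_pos c_pos[of n] unfolding mean_finite[OF 3]
    by (intro powr_mono2 mult_left_mono mult_nonneg_nonneg sum_nonneg) auto
qed

text \<open>The cardinality bound gives \<open>c n * card (S n)\<close> at most 1, so averaging does
  not enlarge a constant.\<close>

lemma mean_const_le:
  assumes "0 \<le> d"
  shows "M n (\<lambda>_. complex_of_real d) \<le> d"
proof (cases n rule: mean_cases)
  case 1
  then show ?thesis using assms by (simp add: mean_0)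
next
  case 2
  show ?thesis using assms finite_sphere S_nonempty by (simp add: mean_infinity[OF 2])
next
  case 3
  then obtain m where m: "n = Suc m" using not0_implies_Suc by blast
  have "real (card (S n)) \<le> real ((q + 1) * q ^ m)"
    using card_sphere_Suc_le[of rt m] unfolding m by (simp only: of_nat_le_iff)
  then have "c n * real (card (S n)) \<le> 1"
    using q_ge_1 by (simp add: c_def m divide_simps distrib_right)
  then have "c n * real (card (S n)) * d powr enn2real p \<le> 1 * d powr enn2real p"
    by (rule mult_right_mono) simp
  then have "M n (\<lambda>_. complex_of_real d) \<le> (d powr enn2real p) powr (1 / enn2real p)"
    using 3 enn2real_p_pos c_pos[of n] assms
    by (auto simp: mean_finite mult.assoc intro!: powr_mono2)
  then show ?thesis using 3 enn2real_p_pos assms by (simp add: powr_powr)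
qed

text \<open>Turns a pointwise bound into a bound on the mean that is the same for every level and
  every exponent.\<close>

lemma mean_le:
  assumes "0 \<le> d" "\<And>v. v \<in> S n \<Longrightarrow> cmod (f v) \<le> d"
  shows "M n f \<le> d"
  using mean_mono[of n f "\<lambda>_. complex_of_real d"] mean_const_le[of d n] assms by simp

lemma mean_eq_0D:
  assumes "M n f = 0" "v \<in> S n"
  shows "f v = 0"
proof (cases n rule: mean_cases)
  case 1
  then show ?thesis using assms by (simp add: mean_0 sphere_0)
next
  case 2
  have "cmod (f v) \<le> M n f" using assms(2) finite_sphere by (simp add: mean_infinity[OF 2])
  then show ?thesis using assms by simp
next
  case 3
  then show ?thesis
    using assms c_pos[of n] finite_sphere by (auto simp: mean_finite sum_nonneg_eq_0_iff)
qed

text \<open>Raising to the power \<open>r\<close> treats all exponents at once: Minkowski for p at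
  least 1, subadditivity of the p-th power below 1.\<close>

lemma mean_triangle: "M n (\<lambda>v. f v + g v) powr r \<le> M n f powr r + M n g powr r"
proof (cases n rule: mean_cases)
  case 1
  \<comment> \<open>At the root the mean is the plain modulus, so the power \<open>r\<close> calls
    for subadditivity here too.\<close>
  have "cmod (f rt + g rt) powr r \<le> (cmod (f rt) + cmod (g rt)) powr r"
    using r_pos by (intro powr_mono2 norm_triangle_ineq) auto
  also have "\<dots> \<le> cmod (f rt) powr r + cmod (g rt) powr r"
    using r_pos r_le_1 by (intro powr_subadd) auto
  finally show ?thesis using 1 by (simp add: mean_0)
next
  case 2
  have "cmod (f v + g v) \<le> M n f + M n g" if "v \<in> S n" for v
    using that finite_sphere
    by (auto simp: mean_infinity[OF 2] intro!: order_trans[OF norm_triangle_ineq] add_mono)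
  then have "M n (\<lambda>v. f v + g v) \<le> M n f + M n g"
    using mean_nonneg by (intro mean_le add_nonneg_nonneg)
  moreover have "r = 1" unfolding r_def using 2 by simp
  ultimately show ?thesis using mean_nonneg by simp
next
  case 3
  let ?P = "enn2real p"
  let ?s = "\<lambda>h. c n * (\<Sum>v\<in>S n. h v powr ?P)"
  have P: "0 < ?P" using 3 enn2real_p_pos by simp
  have le: "?s (\<lambda>v. cmod (f v + g v)) \<le> ?s (\<lambda>v. cmod (f v) + cmod (g v))"
    using P c_pos[of n] by (intro mult_left_mono sum_mono powr_mono2 norm_triangle_ineq) auto
  have nn: "0 \<le> ?s h" for h using c_pos[of n] by (simp add: sum_nonneg)
  show ?thesis
  proof (cases "1 \<le> p")
    case True
    have "?s (\<lambda>v. cmod (f v + g v)) powr (1 / ?P)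
        \<le> ?s (\<lambda>v. cmod (f v) + cmod (g v)) powr (1 / ?P)"
      using P le nn by (intro powr_mono2) auto
    also have "\<dots> \<le> ?s (\<lambda>v. cmod (f v)) powr (1 / ?P) + ?s (\<lambda>v. cmod (g v)) powr (1 / ?P)"
      using True 3 enn2real_p_ge_1 c_pos finite_sphere by (intro minkowski_sum) auto
    finally show ?thesis using True 3 by (simp add: r_def mean_finite)
  next
    case False
    \<comment> \<open>Here \<open>r\<close> is p itself, so it cancels the root in the mean and
      leaves the weighted sums.\<close>
    have "?s (\<lambda>v. cmod (f v) + cmod (g v)) \<le> c n * (\<Sum>v\<in>S n. cmod (f v) powr ?P + cmod (g v) powr ?P)"
      using P p_less_1[OF False] c_pos[of n]
      by (intro mult_left_mono sum_mono powr_subadd) auto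
    then have "?s (\<lambda>v. cmod (f v + g v)) \<le> ?s (\<lambda>v. cmod (f v)) + ?s (\<lambda>v. cmod (g v))"
      using le by (simp add: sum.distrib distrib_left)
    then show ?thesis using False 3 P nn by (simp add: r_def mean_finite powr_powr)
  qed
qed

lemma mean_le_N: "f \<in> T_space q E rt p \<Longrightarrow> M n f \<le> N f"
proof -
  assume "f \<in> T_space q E rt p"
  \<comment> \<open>Finiteness matters: \<open>enn2real\<close> would turn an infinite norm into
    0.\<close>
  then have fin: "T_norm q E rt p f < \<infinity>" by (simp add: T_space_def)
  have "ennreal (M n f) \<le> T_norm q E rt p f"
    unfolding T_norm_def by (rule SUP_upper) simp
  then show ?thesis using fin enn2real_mono mean_nonneg by fastforce
qed

lemma T_spaceI:
  assumes "\<And>n. M n f \<le> C"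
  shows "f \<in> T_space q E rt p" "N f \<le> C"
proof -
  have C: "0 \<le> C" using assms[of 0] mean_nonneg[of 0 f] by simp
  have "T_norm q E rt p f \<le> ennreal C"
    unfolding T_norm_def using assms by (intro SUP_least ennreal_leI)
  then show "f \<in> T_space q E rt p" "N f \<le> C"
    using C by (auto simp: T_space_def enn2real_leI intro: le_less_trans)
qed

lemma T_space_add:
  assumes "f \<in> T_space q E rt p" "g \<in> T_space q E rt p"
  shows "(\<lambda>v. f v + g v) \<in> T_space q E rt p"
    and "N (\<lambda>v. f v + g v) powr r \<le> N f powr r + N g powr r"
proof -
  let ?C = "N f powr r + N g powr r"
  \<comment> \<open>Taking the root 1 / r gives a bound free of n, from which
    \<open>T_spaceI\<close> yields both claims.\<close>
  have le: "M n (\<lambda>v. f v + g v) \<le> ?C powr (1 / r)" for n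
  proof -
    have "M n (\<lambda>v. f v + g v) powr r \<le> M n f powr r + M n g powr r" by (rule mean_triangle)
    also have "\<dots> \<le> ?C"
      using assms r_pos by (intro add_mono powr_mono2 mean_le_N mean_nonneg) auto
    finally have "(M n (\<lambda>v. f v + g v) powr r) powr (1 / r) \<le> ?C powr (1 / r)"
      using r_pos by (intro powr_mono2) auto
    then show ?thesis using r_pos mean_nonneg by (simp add: powr_powr)
  qed
  show "(\<lambda>v. f v + g v) \<in> T_space q E rt p" by (rule T_spaceI(1)[OF le])
  have "N (\<lambda>v. f v + g v) powr r \<le> (?C powr (1 / r)) powr r"
    using T_spaceI(2)[OF le] r_pos by (intro powr_mono2) auto
  then show "N (\<lambda>v. f v + g v) powr r \<le> ?C" using r_pos by (simp add: powr_powr)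
qed

lemma mean_uminus: "M n (\<lambda>v. - f v) = M n f"
  by (intro antisym mean_mono) auto

lemma T_norm_uminus: "T_norm q E rt p (\<lambda>v. - f v) = T_norm q E rt p f"
  by (simp add: T_norm_def mean_uminus)

lemma T_space_diff:
  "f \<in> T_space q E rt p \<Longrightarrow> g \<in> T_space q E rt p \<Longrightarrow> (\<lambda>v. f v - g v) \<in> T_space q E rt p"
  using T_space_add(1)[of f "\<lambda>v. - g v"] by (simp add: T_space_def T_norm_uminus)

text \<open>The two branches of the metric merge, since \<open>powr\<close> with exponent 1 is the
  identity on nonnegative reals.\<close>

lemma T_dist_eq: "T_dist q E rt p f g = N (\<lambda>v. f v - g v) powr r"
  by (simp add: T_dist_def r_def)

sublocale Metric_space "T_space0 q E rt p" "T_dist q E rt p"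
proof
  fix f g h :: "'v \<Rightarrow> complex"
  \<comment> \<open>\<open>Metric_space\<close> demands nonnegativity and symmetry for all
    functions, so both come before membership is assumed.\<close>
  show "0 \<le> T_dist q E rt p f g" by (simp add: T_dist_eq)
  have "(\<lambda>v. g v - f v) = (\<lambda>v. - (f v - g v))" by auto
  then show "T_dist q E rt p f g = T_dist q E rt p g f"
    unfolding T_dist_eq by (metis T_norm_uminus)
  assume "f \<in> T_space0 q E rt p" "g \<in> T_space0 q E rt p"
  then have f: "f \<in> T_space q E rt p" and g: "g \<in> T_space q E rt p"
    by (auto simp: T_space0_def)
  show "T_dist q E rt p f g = 0 \<longleftrightarrow> f = g"
  proof
    assume "T_dist q E rt p f g = 0"
    then have N0: "N (\<lambda>v. f v - g v) = 0" by (simp add: T_dist_eq)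
    have "M n (\<lambda>v. f v - g v) = 0" for n
      using mean_le_N[OF T_space_diff[OF f g], of n] mean_nonneg[of n "\<lambda>v. f v - g v"] N0 by linarith
    \<comment> \<open>Every vertex lies on the sphere of its own level.\<close>
    then have "f v - g v = 0" for v
      by (rule mean_eq_0D[where n = "level E rt v" and f = "\<lambda>v. f v - g v"])
        (simp add: sphere_at_def)
    then show "f = g" by auto
  next
    assume "f = g"
    then have "N (\<lambda>v. f v - g v) \<le> 0" by (intro T_spaceI(2) mean_le) auto
    then have "N (\<lambda>v. f v - g v) = 0" using enn2real_nonneg antisym by blast
    then show "T_dist q E rt p f g = 0" by (simp add: T_dist_eq)
  qed
  assume "h \<in> T_space0 q E rt p"
  then have h: "h \<in> T_space q E rt p" by (auto simp: T_space0_def)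
  show "T_dist q E rt p f h \<le> T_dist q E rt p f g + T_dist q E rt p g h"
    using T_space_add(2)[OF T_space_diff[OF f g] T_space_diff[OF g h]] by (simp add: T_dist_eq)
qed

section \<open>Separability\<close>

definition trunc :: "nat \<Rightarrow> ('v \<Rightarrow> complex) \<Rightarrow> 'v \<Rightarrow> complex" where
  "trunc n f v = (if level E rt v < n then f v else 0)"

lemma finite_ball: "finite {v. level E rt v < n}"
proof -
  have "{v. level E rt v < n} = (\<Union>i<n. S i)" by (auto simp: sphere_at_def)
  then show ?thesis using finite_sphere by simp
qed

lemma mean_trunc_eq_0: "n \<le> m \<Longrightarrow> M m (trunc n f) = 0"
  by (intro antisym mean_nonneg mean_le) (auto simp: trunc_def sphere_at_def)

lemma trunc_in_T_space0: "trunc n f \<in> T_space0 q E rt p"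
proof -
  \<comment> \<open>Only the levels below n contribute, so the sum of their means is a bound uniform
    in m.\<close>
  have "M m (trunc n f) \<le> (\<Sum>i<n. M i (trunc n f))" for m
  proof (cases "m < n")
    case True
    then show ?thesis using mean_nonneg by (intro member_le_sum) auto
  next
    case False
    then show ?thesis using mean_nonneg by (simp add: mean_trunc_eq_0 sum_nonneg)
  qed
  moreover have "\<forall>\<^sub>F m in sequentially. M m (trunc n f) = 0"
    using mean_trunc_eq_0 eventually_sequentially by blast
  ultimately show ?thesis
    by (auto simp: T_space0_def intro: T_spaceI(1) tendsto_eventually)
qed

lemma trunc_approx:
  assumes f: "f \<in> T_space0 q E rt p" and "0 < e"
    and D: "\<And>X :: complex set. open X \<Longrightarrow> X \<noteq> {} \<Longrightarrow> \<exists>d\<in>D. d \<in> X"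
  obtains n g where "\<And>v. g v \<in> D" "T_dist q E rt p f (trunc n g) < e"
proof -
  \<comment> \<open>Chosen so that \<open>d powr r\<close> is e / 2, which leaves room for the
    strict inequality.\<close>
  define d where "d = (e / 2) powr (1 / r)"
  have d: "0 < d" using \<open>0 < e\<close> by (simp add: d_def)
  \<comment> \<open>Decay of the means of f fixes the radius at which to cut.\<close>
  have "\<forall>\<^sub>F m in sequentially. M m f < d"
    using f d by (auto simp: T_space0_def intro: order_tendstoD)
  then obtain n where n: "\<And>m. m \<ge> n \<Longrightarrow> M m f < d"
    by (auto simp: eventually_sequentially)
  have "\<forall>v. \<exists>z\<in>D. z \<in> ball (f v) d"
    using d by (intro allI D) auto
  then obtain g where g: "\<And>v. g v \<in> D" "\<And>v. cmod (f v - g v) < d"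
    by (metis dist_norm mem_ball)
  \<comment> \<open>Below level n the error is f - g, pointwise less than d; from level n on it is f
    itself, whose mean is less than d.\<close>
  have "M m (\<lambda>v. f v - trunc n g v) \<le> d" for m
  proof (cases "m < n")
    case True
    then show ?thesis
      using d g(2) by (intro mean_le) (auto simp: trunc_def sphere_at_def intro: less_imp_le)
  next
    case False
    then have "M m (\<lambda>v. f v - trunc n g v) \<le> M m f"
      by (intro mean_mono) (auto simp: trunc_def sphere_at_def)
    then show ?thesis using n[of m] False by simp
  qed
  then have "N (\<lambda>v. f v - trunc n g v) \<le> d" by (rule T_spaceI(2))
  then have "T_dist q E rt p f (trunc n g) \<le> d powr r"
    unfolding T_dist_eq using r_pos by (intro powr_mono2) auto
  also have "\<dots> < e" using r_pos \<open>0 < e\<close> by (simp add: d_def powr_powr)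
  finally show thesis using that g(1) by blast
qed

text \<open>\<open>trunc n g\<close> depends only on g restricted to a finite ball, so for each n
  these functions are an image of a finite power of \<open>D\<close>.\<close>

lemma countable_trunc:
  fixes D :: "complex set"
  assumes "countable D"
  shows "countable {trunc n g | n g. \<forall>v. g v \<in> D}"
proof -
  have "{trunc n g | n g. \<forall>v. g v \<in> D}
      \<subseteq> (\<Union>n. trunc n ` (PiE {v. level E rt v < n} (\<lambda>_. D)))"
  proof clarify
    fix n and g :: "'v \<Rightarrow> complex" assume g: "\<forall>v. g v \<in> D"
    let ?h = "restrict g {v. level E rt v < n}"
    \<comment> \<open>\<open>restrict\<close> puts \<open>undefined\<close> outside the ball,
      exactly where \<open>trunc n\<close> returns 0.\<close>
    have "trunc n g = trunc n ?h" by (auto simp: trunc_def)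
    moreover have "?h \<in> PiE {v. level E rt v < n} (\<lambda>_. D)" using g by auto
    ultimately show "trunc n g \<in> (\<Union>n. trunc n ` (PiE {v. level E rt v < n} (\<lambda>_. D)))" by blast
  qed
  moreover have "countable (\<Union>n. trunc n ` (PiE {v. level E rt v < n} (\<lambda>_. D)))"
    using assms finite_ball by (intro countable_UN countable_image countable_PiE) auto
  ultimately show ?thesis by (rule countable_subset)
qed

lemma separable_mtopology: "separable_space mtopology"
proof -
  obtain D :: "complex set" where D: "countable D"
    "\<And>X. open X \<Longrightarrow> X \<noteq> {} \<Longrightarrow> \<exists>d\<in>D. d \<in> X"
    using countable_dense_exists by metis
  let ?C = "{trunc n g | n g. \<forall>v. g v \<in> D}"
  \<comment> \<open>Every ball meets the countable set, which is density in the form of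
    \<open>metric_closure_of\<close>.\<close>
  have "\<exists>g\<in>?C. g \<in> mball f e" if f: "f \<in> T_space0 q E rt p" and e: "0 < e" for f e
  proof -
    obtain n g where "\<And>v. g v \<in> D" "T_dist q E rt p f (trunc n g) < e"
      using trunc_approx[OF f e D(2)] by metis
    then show ?thesis using f trunc_in_T_space0 by auto
  qed
  then have "mtopology closure_of ?C = topspace mtopology"
    by (auto simp: metric_closure_of)
  then show ?thesis
    unfolding separable_space_def using countable_trunc[OF D(1)] trunc_in_T_space0
    by (intro exI[of _ ?C]) auto
qed

end

theorem theorem4:
  fixes q :: nat and E :: "'v \<Rightarrow> 'v \<Rightarrow> bool" and rt :: 'v and p :: ennreal
  assumes "q \<ge> 1"
    and "infinite (UNIV :: 'v set)"
    and "homogeneous_tree q E"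
    and "0 < p"
  shows "separable_space (T_top0 q E rt p)"
proof -
  interpret tree_space q E rt p
    using assms by (simp add: tree_space_def tree_space_axioms_def)
  show ?thesis unfolding T_top0_def by (rule separable_mtopology)
qed

end
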